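(* There exists a free $\mathbb{F}_\sigma$ P-filter $F$ on $\omega$ such that the space $N_F$ does not have the bounded Josefson--Nissenzweig property (BJNP).
   Context: A filter $F$ on $\omega$ is free if $\bigcap F=\emptyset$ (equivalently, $F$ contains every cofinite set); filters are proper. $F$ is a P-filter if for every sequence $\langle A_n\rangle$ in $F$ there is $A\in F$ with $A\setminus A_n$ finite for every $n$. Filters are viewed as subsets of the Cantor space $2^\omega$ via characteristic functions; "$\mathbb{F}_\sigma$" refers to this. For a free filter $F$ on $\omega$, $N_F=\omega\cup\{p_F\}$, $p_F\notin\omega$, with the topology in which every point of $\omega$ is isolated and the open neighborhoods of $p_F$ are exactly the sets $A\cup\{p_F\}$ with $A\in F$. A finitely supported measure on a Tychonoff space $X$ is $\mu=\sum_{i=1}^n\alpha_i\delta_{x_i}$ with distinct $x_i\in X$ and $\alpha_i\in\mathbb{R}\setminus\{0\}$; $\|\mu\|=\sum_i|\alpha_i|$, $\mu(f)=\sum_i\alpha_i f(x_i)$. $X$ has the BJNP if there is a sequence $\langle\mu_n: n\in\omega\rangle$ of finitely supported measures on $X$ with $\|\mu_n\|=1$ for all $n$ and $\mu_n(f)\to0$ for every bounded continuous $f:X\to\mathbb{R}$. *)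

theory Defs
  imports "HOL-Analysis.Analysis" "HOL-Library.Poly_Mapping"
begin

definition filter_sets :: "'a filter \<Rightarrow> 'a set set" where
  "filter_sets F = {A. eventually (\<lambda>x. x \<in> A) F}"

(* The type of filters contains the improper filter bot, so properness is part of freeness. *)
definition free_filter :: "'a filter \<Rightarrow> bool" where
  "free_filter F \<longleftrightarrow> F \<noteq> bot \<and> \<Inter>(filter_sets F) = {}"

definition P_filter :: "'a filter \<Rightarrow> bool" where
  "P_filter F \<longleftrightarrow>
     F \<noteq> bot \<and>
     (\<forall>A :: nat \<Rightarrow> 'a set. (\<forall>n. A n \<in> filter_sets F) \<longrightarrow>
        (\<exists>B \<in> filter_sets F. \<forall>n. finite (B - A n)))"

definition cantor_space :: "(nat \<Rightarrow> bool) topology" where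
  "cantor_space = product_topology (\<lambda>_. discrete_topology UNIV) UNIV"

definition fsigma_filter :: "nat filter \<Rightarrow> bool" where
  "fsigma_filter F \<longleftrightarrow> fsigma_in cantor_space ((\<lambda>A n. n \<in> A) ` filter_sets F)"

(* The underlying set of N_F is encoded as nat option: Some n is the point n, None is p_F. *)
definition NF_space :: "nat filter \<Rightarrow> nat option topology" where
  "NF_space F = topology (\<lambda>U. None \<in> U \<longrightarrow> {n. Some n \<in> U} \<in> filter_sets F)"

(* A finitely supported measure is the finitely supported function sending each point x of its
   support to its coefficient, so the points are distinct and the coefficients nonzero. *)
definition fin_supp_measure_on :: "'a topology \<Rightarrow> ('a \<Rightarrow>\<^sub>0 real) \<Rightarrow> bool" where
  "fin_supp_measure_on X \<mu> \<longleftrightarrow> Poly_Mapping.keys \<mu> \<subseteq> topspace X"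

definition measure_norm :: "('a \<Rightarrow>\<^sub>0 real) \<Rightarrow> real" where
  "measure_norm \<mu> = (\<Sum>x\<in>Poly_Mapping.keys \<mu>. \<bar>Poly_Mapping.lookup \<mu> x\<bar>)"

definition measure_apply :: "('a \<Rightarrow>\<^sub>0 real) \<Rightarrow> ('a \<Rightarrow> real) \<Rightarrow> real" where
  "measure_apply \<mu> f = (\<Sum>x\<in>Poly_Mapping.keys \<mu>. Poly_Mapping.lookup \<mu> x * f x)"

definition BJNP :: "'a topology \<Rightarrow> bool" where
  "BJNP X \<longleftrightarrow>
     (\<exists>\<mu> :: nat \<Rightarrow> ('a \<Rightarrow>\<^sub>0 real).
        (\<forall>n. fin_supp_measure_on X (\<mu> n) \<and> measure_norm (\<mu> n) = 1) \<and>
        (\<forall>f. continuous_map X euclideanreal f \<and> bounded (f ` topspace X) \<longrightarrow>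
             (\<lambda>n. measure_apply (\<mu> n) f) \<longlonglongrightarrow> 0))"

lemma openin_NF_space:
  "openin (NF_space F) U \<longleftrightarrow> (None \<in> U \<longrightarrow> {n. Some n \<in> U} \<in> filter_sets F)"
proof -
  have "istopology (\<lambda>U. None \<in> U \<longrightarrow> {n. Some n \<in> U} \<in> filter_sets F)"
    unfolding istopology_def filter_sets_def
    by (auto simp: eventually_conj_iff elim!: eventually_mono)
  then show ?thesis
    by (simp add: NF_space_def)
qed

lemma topspace_NF_space [simp]: "topspace (NF_space F) = UNIV"
  using openin_subset[of "NF_space F" UNIV] by (auto simp: openin_NF_space filter_sets_def)

lemma free_filter_compl_singleton:
  assumes "free_filter F" shows "- {x} \<in> filter_sets F"
proof -
  obtain A where "A \<in> filter_sets F" "x \<notin> A"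
    using assms by (auto simp: free_filter_def)
  then show ?thesis
    by (auto simp: filter_sets_def elim!: eventually_mono)
qed

lemma free_filter_iff_cofinite: "free_filter F \<longleftrightarrow> F \<noteq> bot \<and> F \<le> cofinite"
proof
  assume free: "free_filter F"
  have "eventually P F" if "finite {x. \<not> P x}" for P
  proof -
    have "\<forall>x\<in>{x. \<not> P x}. eventually (\<lambda>y. y \<noteq> x) F"
      using free_filter_compl_singleton[OF free] by (auto simp: filter_sets_def)
    then have "eventually (\<lambda>y. \<forall>x\<in>{x. \<not> P x}. y \<noteq> x) F"
      by (rule eventually_ball_finite[OF that])
    then show ?thesis
      by (auto elim!: eventually_mono)
  qed
  then show "F \<noteq> bot \<and> F \<le> cofinite"
    using free by (auto simp: free_filter_def le_filter_def eventually_cofinite)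
next
  assume F: "F \<noteq> bot \<and> F \<le> cofinite"
  then have "- {x} \<in> filter_sets F" for x
    by (auto simp: filter_sets_def le_filter_def eventually_cofinite)
  then show "free_filter F"
    using F by (auto simp: free_filter_def)
qed

lemma Hausdorff_NF_space:
  assumes "free_filter F" shows "Hausdorff_space (NF_space F)"
  unfolding Hausdorff_space_def
proof (intro allI impI, elim conjE)
  fix x y :: "nat option"
  assume "x \<noteq> y"
  have compl: "openin (NF_space F) (- {Some n})" for n
    using free_filter_compl_singleton[OF assms, of n]
    by (auto simp: openin_NF_space filter_sets_def)
  have single: "openin (NF_space F) {Some n}" for n
    by (simp add: openin_NF_space)
  consider n where "x = Some n" | n where "y = Some n"
    using \<open>x \<noteq> y\<close> by (cases x; cases y) auto
  then show "\<exists>U V. openin (NF_space F) U \<and> openin (NF_space F) V \<and> x \<in> U \<and> y \<in> V \<and> disjnt U V"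
  proof cases
    case 1
    then show ?thesis
      using compl single \<open>x \<noteq> y\<close> by (intro exI[of _ "{x}"] exI[of _ "- {x}"]) (auto simp: disjnt_def)
  next
    case 2
    then show ?thesis
      using compl single \<open>x \<noteq> y\<close> by (intro exI[of _ "- {y}"] exI[of _ "{y}"]) (auto simp: disjnt_def)
  qed
qed

end

theory Submission
  imports Defs
begin

text \<open>The ideal dual to the filter is built from pathological submeasures on finite blocks. The
  block of level \<open>n\<close> is covered by \<open>2 ^ Suc n\<close> sets such that every point lies in at least half of
  them, while more than \<open>2 ^ n\<close> of them are needed to cover the block. The ideal consists of the
  sets whose covering numbers, divided by \<open>2 ^ n\<close>, have a finite sum over all levels; this makes it
  a proper \<open>F\<^sub>\<sigma>\<close> P-ideal. For any measure, some covering set carries half of the mass of its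
  block, and picking one covering set per level costs only \<open>\<Sum>n. 1 / 2 ^ n\<close>. Hence, by a gliding
  hump argument, a sequence of measures that vanishes on finite sets has a subsequence bounded away
  from zero on one set of the ideal. The signs of the measures on this set give a continuous test
  function that contradicts the BJNP.\<close>

section \<open>Blocks of points and their enumeration\<close>

text \<open>A point is a pair \<open>(n, y)\<close> where \<open>y\<close> is the set of indices of the covering sets of level \<open>n\<close>
  that miss the point.\<close>

definition points :: "(nat \<times> nat set) set" where
  "points = (SIGMA n:UNIV. {y. y \<subseteq> {..<2 ^ Suc n} \<and> card y \<le> 2 ^ n})"

definition level :: "nat \<Rightarrow> nat" where
  "level m = fst (from_nat_into points m)"

definition missed :: "nat \<Rightarrow> nat set" where
  "missed m = snd (from_nat_into points m)"

text \<open>\<open>J\<close> names a subfamily of the covering sets of level \<open>n\<close> by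
  indices. Covering set \<open>i\<close> contains \<open>m\<close> exactly when \<open>i\<close> is
  not in \<open>missed m\<close>, so \<open>\<not> J \<subseteq> missed m\<close> says that some
  member of \<open>J\<close> contains \<open>m\<close>.\<close>

definition covers :: "nat set \<Rightarrow> nat \<Rightarrow> nat set \<Rightarrow> bool" where
  "covers J n A \<longleftrightarrow> J \<subseteq> {..<2 ^ Suc n} \<and> (\<forall>m\<in>A. level m = n \<longrightarrow> \<not> J \<subseteq> missed m)"

definition cover_number :: "nat \<Rightarrow> nat set \<Rightarrow> nat" where
  "cover_number n A = (LEAST k. \<exists>J. covers J n A \<and> card J = k)"

text \<open>Partial sums of the series depend on finitely many points, which makes the ideal
  F_sigma; its tails become small, which gives the P-property.\<close>

definition cover_ideal :: "nat set set" where
  "cover_ideal = {A. summable (\<lambda>n. cover_number n A / 2 ^ n)}"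

definition cover_filter :: "nat filter" where
  "cover_filter = Abs_filter (\<lambda>P. {m. \<not> P m} \<in> cover_ideal)"

text \<open>\<open>from_nat_into\<close> enumerates bijectively because the set is countably
  infinite: each level is finite, and the empty set is a legal second component at every
  level.\<close>

lemma bij_points: "bij_betw (from_nat_into points) UNIV points"
proof (rule bij_betw_from_nat_into)
  have "finite {y. y \<subseteq> {..<2 ^ Suc n :: nat} \<and> card y \<le> 2 ^ n}" for n :: nat
    by (rule finite_subset[of _ "Pow {..<2 ^ Suc n}"]) auto
  then show "countable points"
    unfolding points_def by (intro countable_SIGMA) (auto intro: countable_finite)
  have "range (\<lambda>n. (n, {})) \<subseteq> points"
    by (auto simp: points_def)
  moreover have "infinite (range (\<lambda>n::nat. (n, {}::nat set)))"
    by (rule range_inj_infinite) (auto simp: inj_on_def)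
  ultimately show "infinite points"
    using finite_subset by blast
qed

lemma point_in_points: "(level m, missed m) \<in> points"
  using bij_betwE[OF bij_points] by (simp add: level_def missed_def)

lemma missed_subset: "missed m \<subseteq> {..<2 ^ Suc (level m)}"
  and card_missed_le: "card (missed m) \<le> 2 ^ level m"
  using point_in_points[of m] by (auto simp: points_def)

lemma ex_point:
  assumes "J \<subseteq> {..<2 ^ Suc n}" "card J \<le> 2 ^ n"
  shows "\<exists>m. level m = n \<and> missed m = J"
proof -
  have "(n, J) \<in> points"
    using assms by (simp add: points_def)
  then obtain m where "from_nat_into points m = (n, J)"
    using bij_betw_imp_surj_on[OF bij_points] by (metis imageE)
  then show ?thesis
    by (intro exI[of _ m]) (simp add: level_def missed_def)
qed

lemma finite_level: "finite {m. level m = n}"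
proof -
  have "finite (Pow {..<2 ^ Suc n :: nat})"
    by simp
  moreover have "missed ` {m. level m = n} \<subseteq> Pow {..<2 ^ Suc n}"
    using missed_subset by auto
  ultimately have "finite (missed ` {m. level m = n})"
    using finite_subset by blast
  moreover have "inj_on missed {m. level m = n}"
    using bij_betw_imp_inj_on[OF bij_points]
    by (auto simp: inj_on_def level_def missed_def prod_eq_iff)
  ultimately show ?thesis
    by (rule finite_imageD)
qed

lemma finite_level_less: "finite {m. level m < n}"
proof -
  have "{m. level m < n} = (\<Union>k<n. {m. level m = k})"
    by auto
  then show ?thesis
    using finite_level by simp
qed

section \<open>Covering numbers of a single level\<close>

text \<open>Each point is missed by at most half of the covering sets of its level. Hence the full
  family covers, and the \<open>LEAST\<close> in \<open>cover_number\<close> is attained.\<close>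

lemma covers_all: "covers {..<2 ^ Suc n} n A"
proof -
  have "\<not> {..<2 ^ Suc (level m)} \<subseteq> missed m" for m
  proof
    assume "{..<2 ^ Suc (level m)} \<subseteq> missed m"
    then have "card {..<2 ^ Suc (level m) :: nat} \<le> card (missed m)"
      using missed_subset by (meson card_mono finite_lessThan finite_subset)
    then have "2 * 2 ^ level m \<le> card (missed m)"
      by simp
    moreover have "0 < (2 :: nat) ^ level m"
      by simp
    ultimately show False
      using card_missed_le[of m] by linarith
  qed
  then show ?thesis
    by (auto simp: covers_def)
qed

lemma ex_min_cover: "\<exists>J. covers J n A \<and> card J = cover_number n A"
  unfolding cover_number_def by (rule LeastI_ex) (use covers_all in blast)

lemma cover_number_le: "covers J n A \<Longrightarrow> cover_number n A \<le> card J"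
  unfolding cover_number_def by (rule Least_le) blast

lemma cover_number_eq_0: "(\<And>m. m \<in> A \<Longrightarrow> level m \<noteq> n) \<Longrightarrow> cover_number n A = 0"
  using cover_number_le[of "{}" n A] by (auto simp: covers_def)

lemma cover_number_empty [simp]: "cover_number n {} = 0"
  by (rule cover_number_eq_0) simp

text \<open>Only the parts on level \<open>n\<close> are compared, so the lemma also applies to sets
  that are related on some levels only.\<close>

lemma cover_number_mono_level:
  assumes "\<And>m. m \<in> A \<Longrightarrow> level m = n \<Longrightarrow> m \<in> B"
  shows "cover_number n A \<le> cover_number n B"
proof -
  obtain J where "covers J n B" "card J = cover_number n B"
    using ex_min_cover by blast
  then show ?thesis
    using cover_number_le[of J n A] assms by (auto simp: covers_def)
qed

lemma cover_number_mono: "A \<subseteq> B \<Longrightarrow> cover_number n A \<le> cover_number n B"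
  by (rule cover_number_mono_level) auto

lemma cover_number_Un: "cover_number n (A \<union> B) \<le> cover_number n A + cover_number n B"
proof -
  obtain J K where JK: "covers J n A" "card J = cover_number n A"
      "covers K n B" "card K = cover_number n B"
    using ex_min_cover by meson
  then have "covers (J \<union> K) n (A \<union> B)"
    by (auto simp: covers_def)
  then have "cover_number n (A \<union> B) \<le> card (J \<union> K)"
    by (rule cover_number_le)
  also have "\<dots> \<le> card J + card K"
    by (rule card_Un_le)
  finally show ?thesis
    using JK by simp
qed

lemma cover_number_UN:
  assumes "finite I"
  shows "cover_number n (\<Union>i\<in>I. A i) \<le> (\<Sum>i\<in>I. cover_number n (A i))"
  using assms
proof (induction I rule: finite_induct)
  case (insert i I)
  have "cover_number n (A i \<union> (\<Union>i\<in>I. A i)) \<le> cover_number n (A i) + cover_number n (\<Union>i\<in>I. A i)"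
    by (rule cover_number_Un)
  then show ?case
    using insert by simp
qed simp

text \<open>A covering family \<open>J\<close> with at most \<open>2 ^ n\<close> members would
  itself be \<open>missed m\<close> for some point \<open>m\<close> of level \<open>n\<close>, and
  no member of \<open>J\<close> contains that point.\<close>

lemma cover_number_UNIV: "2 ^ n < cover_number n UNIV"
proof (rule ccontr)
  assume *: "\<not> 2 ^ n < cover_number n UNIV"
  obtain J where J: "covers J n UNIV" "card J = cover_number n UNIV"
    using ex_min_cover by blast
  then obtain m where "level m = n" "missed m = J"
    using ex_point[of J n] * by (auto simp: covers_def)
  with J show False
    by (auto simp: covers_def)
qed

section \<open>The ideal of sets with summable covering numbers\<close>

lemma cover_ideal_subset:
  assumes "B \<in> cover_ideal" "A \<subseteq> B"
  shows "A \<in> cover_ideal"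
proof -
  have "summable (\<lambda>n. cover_number n B / 2 ^ n)"
    using assms by (simp add: cover_ideal_def)
  then show ?thesis
    unfolding cover_ideal_def mem_Collect_eq
    by (rule summable_comparison_test')
       (use cover_number_mono[OF assms(2)] in \<open>auto simp: divide_right_mono\<close>)
qed

lemma cover_ideal_Un:
  assumes "A \<in> cover_ideal" "B \<in> cover_ideal"
  shows "A \<union> B \<in> cover_ideal"
proof -
  have "summable (\<lambda>n. cover_number n A / 2 ^ n + cover_number n B / 2 ^ n)"
    using assms by (intro summable_add) (simp_all add: cover_ideal_def)
  then have "summable (\<lambda>n. cover_number n (A \<union> B) / 2 ^ n)"
  proof (rule summable_comparison_test')
    fix n
    have "real (cover_number n (A \<union> B)) \<le> cover_number n A + cover_number n B"
      using cover_number_Un by (metis of_nat_add of_nat_le_iff)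
    then show "norm (cover_number n (A \<union> B) / 2 ^ n)
        \<le> cover_number n A / 2 ^ n + cover_number n B / 2 ^ n"
      by (simp add: divide_right_mono flip: add_divide_distrib)
  qed
  then show ?thesis
    by (simp add: cover_ideal_def)
qed

text \<open>All terms of the series exceed 1, so they cannot tend to 0.\<close>

lemma UNIV_notin_cover_ideal: "UNIV \<notin> cover_ideal"
proof
  assume "UNIV \<in> cover_ideal"
  then have "(\<lambda>n. cover_number n UNIV / 2 ^ n) \<longlonglongrightarrow> 0"
    unfolding cover_ideal_def by (simp add: summable_LIMSEQ_zero)
  then have "eventually (\<lambda>n. cover_number n UNIV / 2 ^ n < (1::real)) sequentially"
    by (rule order_tendstoD) simp
  then obtain n where "cover_number n UNIV / 2 ^ n < (1::real)"
    using eventually_happens'[OF sequentially_bot] by blast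
  then have "real (cover_number n UNIV) < real (2 ^ n)"
    by (simp add: divide_less_eq)
  then show False
    using cover_number_UNIV[of n] by linarith
qed

lemma finite_in_cover_ideal:
  assumes "finite A"
  shows "A \<in> cover_ideal"
proof -
  have "summable (\<lambda>n. cover_number n A / 2 ^ n)"
    by (rule summable_finite[of "level ` A"])
       (use assms in \<open>auto intro!: cover_number_eq_0\<close>)
  then show ?thesis
    by (simp add: cover_ideal_def)
qed

text \<open>A single covering set suffices on each level, so the series is dominated by
  \<open>(1 / 2) ^ n\<close>. Such a set will carry the test function against the BJNP.\<close>

lemma transversal_in_cover_ideal:
  assumes "\<And>n. i n < 2 ^ Suc n"
  shows "{m. i (level m) \<notin> missed m} \<in> cover_ideal"
proof -
  have "cover_number n {m. i (level m) \<notin> missed m} \<le> 1" for n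
    using cover_number_le[of "{i n}" n "{m. i (level m) \<notin> missed m}"] assms
    by (auto simp: covers_def simp del: power_Suc)
  then have le: "norm (cover_number n {m. i (level m) \<notin> missed m} / 2 ^ n :: real) \<le> (1 / 2) ^ n" for n
    by (simp add: power_one_over divide_right_mono)
  have "summable (\<lambda>n. (1 / 2 :: real) ^ n)"
    by (rule summable_geometric) simp
  then show ?thesis
    unfolding cover_ideal_def mem_Collect_eq by (rule summable_comparison_test') (rule le)
qed

section \<open>The dual filter\<close>

text \<open>\<open>Abs_filter\<close> can be unfolded once \<open>is_filter\<close> holds, which
  follows from closure of the ideal under subsets and finite unions.\<close>

lemma eventually_cover_filter: "eventually P cover_filter \<longleftrightarrow> {m. \<not> P m} \<in> cover_ideal"
proof -
  have "is_filter (\<lambda>P. {m. \<not> P m} \<in> cover_ideal)"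
  proof
    fix P Q :: "nat \<Rightarrow> bool"
    assume "{m. \<not> P m} \<in> cover_ideal" "{m. \<not> Q m} \<in> cover_ideal"
    then have "{m. \<not> P m} \<union> {m. \<not> Q m} \<in> cover_ideal"
      by (rule cover_ideal_Un)
    then show "{m. \<not> (P m \<and> Q m)} \<in> cover_ideal"
      by (rule cover_ideal_subset) auto
  qed (auto intro: finite_in_cover_ideal elim: cover_ideal_subset)
  then show ?thesis
    unfolding cover_filter_def by (rule eventually_Abs_filter)
qed

lemma filter_sets_cover_filter: "filter_sets cover_filter = {A. - A \<in> cover_ideal}"
  by (simp add: filter_sets_def eventually_cover_filter Compl_eq)

lemma cover_filter_neq_bot: "cover_filter \<noteq> bot"
  using UNIV_notin_cover_ideal by (auto simp: trivial_limit_def eventually_cover_filter)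

lemma free_cover_filter: "free_filter cover_filter"
  unfolding free_filter_iff_cofinite le_filter_def
  by (auto simp: cover_filter_neq_bot eventually_cover_filter eventually_cofinite
      intro: finite_in_cover_ideal)

section \<open>The filter as a countable union of closed sets\<close>

text \<open>Fixing the coordinates in \<open>S\<close> to the values of \<open>f\<close> gives a
  basic open cylinder around \<open>f\<close> inside \<open>U\<close>.\<close>

lemma openin_cantor_space_finite_dependence:
  assumes "finite S" and dep: "\<And>f g. (\<And>i. i \<in> S \<Longrightarrow> f i = g i) \<Longrightarrow> f \<in> U \<Longrightarrow> g \<in> U"
  shows "openin cantor_space U"
proof (subst openin_subopen, intro ballI exI conjI)
  fix f assume "f \<in> U"
  let ?B = "\<lambda>i. if i \<in> S then {f i} else UNIV"
  have "finite {i. ?B i \<noteq> UNIV}"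
    using assms(1) by (rule rev_finite_subset) auto
  then show "openin cantor_space (PiE UNIV ?B)"
    unfolding cantor_space_def by (intro product_topology_basis) auto
  show "f \<in> PiE UNIV ?B"
    by (auto simp: PiE_UNIV_domain)
  show "PiE UNIV ?B \<subseteq> U"
  proof
    fix g assume "g \<in> PiE UNIV ?B"
    then have "g i = f i" if "i \<in> S" for i
      using PiE_mem[OF \<open>g \<in> PiE UNIV ?B\<close>, of i] that by simp
    then show "g \<in> U"
      using dep[of f g] \<open>f \<in> U\<close> by auto
  qed
qed

lemma closedin_cantor_space_finite_dependence:
  assumes "finite S" and dep: "\<And>f g. (\<And>i. i \<in> S \<Longrightarrow> f i = g i) \<Longrightarrow> f \<in> U \<Longrightarrow> g \<in> U"
  shows "closedin cantor_space U"
proof -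
  have "g \<in> - U" if "\<And>i. i \<in> S \<Longrightarrow> f i = g i" "f \<in> - U" for f g
    using dep[of g f] that by auto
  then have "openin cantor_space (- U)"
    by (rule openin_cantor_space_finite_dependence[OF assms(1)])
  then show ?thesis
    by (simp add: closedin_def cantor_space_def Compl_eq_Diff_UNIV)
qed

text \<open>The terms are nonnegative, so summability means that all partial sums stay below some
  natural \<open>K\<close>. For fixed \<open>K\<close> and \<open>N\<close> this is a closed
  condition, as it concerns only the finitely many points of level below \<open>N\<close>.\<close>

lemma fsigma_cover_filter: "fsigma_filter cover_filter"
proof -
  define C :: "nat \<Rightarrow> nat \<Rightarrow> (nat \<Rightarrow> bool) set" where
    "C K N = {f. (\<Sum>n<N. cover_number n {m. \<not> f m} / 2 ^ n) \<le> real K}" for K N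
  have "closedin cantor_space (C K N)" for K N
  proof (rule closedin_cantor_space_finite_dependence[OF finite_level_less[of N]])
    fix f g assume fg: "\<And>m. m \<in> {m. level m < N} \<Longrightarrow> f m = g m" and f: "f \<in> C K N"
    have "cover_number n {m. \<not> f m} = cover_number n {m. \<not> g m}" if "n < N" for n
      by (rule antisym; rule cover_number_mono_level) (use fg that in auto)
    then show "g \<in> C K N"
      using f by (simp add: C_def)
  qed
  then have "fsigma_in cantor_space (\<Inter>N. C K N)" for K
    by (intro closed_imp_fsigma_in closedin_INT) auto
  then have "fsigma_in cantor_space (\<Union>K. \<Inter>N. C K N)"
    by (intro fsigma_in_Union) auto
  moreover have "(\<lambda>A n. n \<in> A) ` filter_sets cover_filter = (\<Union>K. \<Inter>N. C K N)"
  proof (intro set_eqI iffI)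
    fix f assume "f \<in> (\<lambda>A n. n \<in> A) ` filter_sets cover_filter"
    then have "{m. \<not> f m} \<in> cover_ideal"
      by (auto simp: filter_sets_cover_filter Compl_eq)
    then have sm: "summable (\<lambda>n. cover_number n {m. \<not> f m} / 2 ^ n)"
      by (simp add: cover_ideal_def)
    obtain K where K: "suminf (\<lambda>n. cover_number n {m. \<not> f m} / 2 ^ n) \<le> real K"
      using real_arch_simple by blast
    have "(\<Sum>n<N. cover_number n {m. \<not> f m} / 2 ^ n) \<le> real K" for N
      using sum_le_suminf[OF sm, of "{..<N}"] K by auto
    then show "f \<in> (\<Union>K. \<Inter>N. C K N)"
      by (auto simp: C_def)
  next
    fix f assume "f \<in> (\<Union>K. \<Inter>N. C K N)"
    then obtain K where "\<And>N. (\<Sum>n<N. cover_number n {m. \<not> f m} / 2 ^ n) \<le> real K"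
      by (auto simp: C_def)
    then have "summable (\<lambda>n. cover_number n {m. \<not> f m} / 2 ^ n)"
      by (intro summableI_nonneg_bounded[of _ "real K"]) simp_all
    then have "{m. f m} \<in> filter_sets cover_filter"
      by (simp add: filter_sets_cover_filter cover_ideal_def Compl_eq)
    then show "f \<in> (\<lambda>A n. n \<in> A) ` filter_sets cover_filter"
      by (rule rev_image_eqI) simp
  qed
  ultimately show ?thesis
    by (simp add: fsigma_filter_def)
qed

section \<open>The P-property\<close>

text \<open>From each \<open>A j\<close> the finitely many points below a level \<open>N j\<close>
  are dropped, with \<open>N j\<close> so large that the remaining series sums to at most
  \<open>(1 / 2) ^ j\<close>. The union of the remainders then has sum at most 2.\<close>

lemma cover_ideal_pseudo_union:
  assumes A: "\<And>j. A j \<in> cover_ideal"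
  shows "\<exists>B\<in>cover_ideal. \<forall>j :: nat. finite (A j - B)"
proof -
  let ?c = "\<lambda>j n. cover_number n (A j) / 2 ^ n :: real"
  \<comment> \<open>The bound \<open>N \<ge> j\<close> ensures that only the finitely many
    \<open>j \<le> n\<close> contribute to level \<open>n\<close>, so finite subadditivity is
    enough.\<close>
  have ex: "\<exists>N\<ge>j. \<forall>M. (\<Sum>n\<in>{N..<M}. ?c j n) \<le> (1 / 2) ^ j" for j
  proof -
    have "summable (?c j)"
      using A by (simp add: cover_ideal_def)
    moreover have "(0 :: real) < (1 / 2) ^ j"
      by simp
    ultimately obtain N where N: "\<And>m n. m \<ge> N \<Longrightarrow> norm (sum (?c j) {m..<n}) < (1 / 2) ^ j"
      unfolding summable_Cauchy by blast
    show ?thesis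
      by (rule exI[of _ "max j N"]) (use N[of "max j N"] in \<open>auto intro: less_imp_le abs_le_D1\<close>)
  qed
  have "\<exists>N. \<forall>j. N j \<ge> j \<and> (\<forall>M. (\<Sum>n\<in>{N j..<M}. ?c j n) \<le> (1 / 2) ^ j)"
    by (intro choice allI ex)
  then obtain N where N: "\<And>j. N j \<ge> j" "\<And>j M. (\<Sum>n\<in>{N j..<M}. ?c j n) \<le> (1 / 2) ^ j"
    by blast
  define B where "B = (\<Union>j. {m \<in> A j. N j \<le> level m})"
  have le: "cover_number n B \<le> (\<Sum>j\<in>{j. j < M \<and> N j \<le> n}. cover_number n (A j))" if "n < M" for n M
  proof -
    have "cover_number n B \<le> cover_number n (\<Union>j\<in>{j. j < M \<and> N j \<le> n}. A j)"
    proof (rule cover_number_mono_level)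
      fix m assume "m \<in> B" "level m = n"
      then obtain j where "m \<in> A j" "N j \<le> n"
        by (auto simp: B_def)
      then show "m \<in> (\<Union>j\<in>{j. j < M \<and> N j \<le> n}. A j)"
        using order.strict_trans1[OF order.trans[OF N(1)[of j] \<open>N j \<le> n\<close>] that] by blast
    qed
    also have "\<dots> \<le> (\<Sum>j\<in>{j. j < M \<and> N j \<le> n}. cover_number n (A j))"
      by (rule cover_number_UN) simp
    finally show ?thesis .
  qed
  have "(\<Sum>n<M. cover_number n B / 2 ^ n :: real) \<le> 2" for M
  proof -
    have "(\<Sum>n<M. cover_number n B / 2 ^ n :: real)
        \<le> (\<Sum>n<M. \<Sum>j\<in>{j. j < M \<and> N j \<le> n}. ?c j n)"
    proof (rule sum_mono)
      fix n assume "n \<in> {..<M}"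
      then have "real (cover_number n B) \<le> (\<Sum>j\<in>{j. j < M \<and> N j \<le> n}. cover_number n (A j))"
        using le[of n M] by (metis lessThan_iff of_nat_le_iff)
      then show "cover_number n B / 2 ^ n \<le> (\<Sum>j\<in>{j. j < M \<and> N j \<le> n}. ?c j n)"
        by (simp add: divide_right_mono flip: sum_divide_distrib)
    qed
    \<comment> \<open>After the exchange of sums, row \<open>j\<close> is a tail of the series of
      \<open>A j\<close> starting at \<open>N j\<close>.\<close>
    also have "\<dots> = (\<Sum>j<M. \<Sum>n\<in>{n. n < M \<and> N j \<le> n}. ?c j n)"
      using sum.swap_restrict[of "{..<M}" "{..<M}" "\<lambda>n j. ?c j n" "\<lambda>n j. N j \<le> n"]
      by (simp add: lessThan_iff)
    also have "\<dots> = (\<Sum>j<M. \<Sum>n\<in>{N j..<M}. ?c j n)"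
      by (intro sum.cong refl) auto
    also have "\<dots> \<le> (\<Sum>j<M. (1 / 2) ^ j)"
      by (intro sum_mono N)
    also have "(\<Sum>j<M. (1 / 2 :: real) ^ j) = 2 - 2 * (1 / 2) ^ M"
      by (induction M) auto
    also have "\<dots> \<le> 2"
      by simp
    finally show ?thesis .
  qed
  then have "summable (\<lambda>n. cover_number n B / 2 ^ n :: real)"
    by (intro summableI_nonneg_bounded[of _ 2]) simp_all
  moreover have "finite (A j - B)" for j
    by (rule finite_subset[OF _ finite_level_less[of "N j"]]) (auto simp: B_def not_le)
  ultimately show ?thesis
    by (auto simp: cover_ideal_def)
qed

lemma P_filter_cover_filter: "P_filter cover_filter"
  unfolding P_filter_def
proof (intro conjI allI impI)
  fix A :: "nat \<Rightarrow> nat set"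
  assume "\<forall>n. A n \<in> filter_sets cover_filter"
  then obtain B where "B \<in> cover_ideal" "\<And>n. finite (- A n - B)"
    using cover_ideal_pseudo_union[of "\<lambda>n. - A n"] by (auto simp: filter_sets_cover_filter)
  moreover have "- B - A n = - A n - B" for n
    by auto
  ultimately show "\<exists>B\<in>filter_sets cover_filter. \<forall>n. finite (B - A n)"
    by (intro bexI[of _ "- B"]) (auto simp: filter_sets_cover_filter)
qed (rule cover_filter_neq_bot)

section \<open>Heavy covering sets\<close>

text \<open>Every point of level \<open>n\<close> lies in at least half of the \<open>2 ^ Suc n\<close> covering sets, so on average
  these carry half of the mass.\<close>

lemma ex_heavy_covering_set:
  fixes w :: "nat \<Rightarrow> real"
  assumes w: "\<And>m. w m \<ge> 0"
  shows "\<exists>i<2 ^ Suc n. (\<Sum>m | level m = n. w m) \<le> 2 * (\<Sum>m | level m = n \<and> i \<notin> missed m. w m)"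
proof (rule ccontr)
  let ?P = "{m. level m = n}" and ?I = "{..<2 ^ Suc n :: nat}"
  assume "\<not> ?thesis"
  then have "2 * (\<Sum>m | level m = n \<and> i \<notin> missed m. w m) < (\<Sum>m\<in>?P. w m)" if "i \<in> ?I" for i
    using that by (auto simp: not_le)
  then have "(\<Sum>i\<in>?I. 2 * (\<Sum>m | level m = n \<and> i \<notin> missed m. w m)) < (\<Sum>i\<in>?I. \<Sum>m\<in>?P. w m)"
    by (intro sum_strict_mono) (auto simp: lessThan_empty_iff)
  \<comment> \<open>Double counting: the right-hand sum counts each point once for every covering
    set that contains it, hence at least \<open>2 ^ n\<close> times before the factor 2.\<close>
  moreover have "(\<Sum>i\<in>?I. \<Sum>m\<in>?P. w m) \<le> (\<Sum>i\<in>?I. 2 * (\<Sum>m | level m = n \<and> i \<notin> missed m. w m))"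
  proof -
    have "2 ^ n \<le> card {i \<in> ?I. i \<notin> missed m}" if "level m = n" for m
    proof -
      have "{i \<in> ?I. i \<notin> missed m} = ?I - missed m"
        by auto
      then have "card {i \<in> ?I. i \<notin> missed m} = 2 ^ Suc n - card (missed m)"
        using missed_subset[of m] that by (simp add: card_Diff_subset finite_subset)
      then show ?thesis
        using card_missed_le[of m] that by simp
    qed
    then have "real (2 ^ n) \<le> real (card {i \<in> ?I. i \<notin> missed m})" if "level m = n" for m
      using that of_nat_le_iff by blast
    then have "2 ^ n * w m \<le> card {i \<in> ?I. i \<notin> missed m} * w m" if "m \<in> ?P" for m
      using that w by (intro mult_right_mono) auto
    then have "(\<Sum>m\<in>?P. 2 ^ n * w m) \<le> (\<Sum>m\<in>?P. card {i \<in> ?I. i \<notin> missed m} * w m)"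
      by (intro sum_mono)
    also have "\<dots> = (\<Sum>m\<in>?P. \<Sum>i | i \<in> ?I \<and> i \<notin> missed m. w m)"
      by simp
    also have "\<dots> = (\<Sum>i\<in>?I. \<Sum>m | m \<in> ?P \<and> i \<notin> missed m. w m)"
      by (rule sum.swap_restrict) (auto simp: finite_level)
    finally have "2 * (\<Sum>m\<in>?P. 2 ^ n * w m)
        \<le> 2 * (\<Sum>i\<in>?I. \<Sum>m | level m = n \<and> i \<notin> missed m. w m)"
      by simp
    moreover have "(\<Sum>i\<in>?I. \<Sum>m\<in>?P. w m) = 2 * (\<Sum>m\<in>?P. 2 ^ n * w m)"
      by (simp add: sum_distrib_left mult.assoc)
    moreover have "(\<Sum>i\<in>?I. 2 * (\<Sum>m | level m = n \<and> i \<notin> missed m. w m))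
        = 2 * (\<Sum>i\<in>?I. \<Sum>m | level m = n \<and> i \<notin> missed m. w m)"
      by (rule sum_distrib_left[symmetric])
    ultimately show ?thesis
      by linarith
  qed
  ultimately show False
    by linarith
qed

lemma sum_by_level:
  fixes h :: "nat \<Rightarrow> real"
  shows "(\<Sum>m | a \<le> level m \<and> level m < b. h m) = (\<Sum>l = a..<b. \<Sum>m | level m = l. h m)"
proof -
  let ?S = "{m. a \<le> level m \<and> level m < b}"
  have "finite ?S"
    by (rule finite_subset[OF _ finite_level_less[of b]]) auto
  then have "sum h ?S = (\<Sum>l = a..<b. sum h {m \<in> ?S. level m = l})"
    by (intro sum.group[symmetric]) auto
  also have "\<dots> = (\<Sum>l = a..<b. \<Sum>m | level m = l. h m)"
    by (intro sum.cong refl) auto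
  finally show ?thesis .
qed

section \<open>Functions and measures on the space \<open>NF_space F\<close>\<close>

text \<open>Openness of a preimage is a condition only if it contains \<open>None\<close>, and then
  it contains the filter set on which \<open>f\<close> takes the value
  \<open>f None\<close>.\<close>

lemma continuous_map_NF_space:
  assumes "{m. f (Some m) = f None} \<in> filter_sets F"
  shows "continuous_map (NF_space F) X f \<longleftrightarrow> range f \<subseteq> topspace X"
  using assms
  by (auto simp: continuous_map_def openin_NF_space filter_sets_def elim: eventually_mono)

text \<open>Separates the point \<open>None\<close> and replaces the support by any larger finite
  set \<open>S\<close>, so that all measures can be summed over whole ranges of levels.\<close>

lemma sum_keys_option:
  fixes \<mu> :: "nat option \<Rightarrow>\<^sub>0 real"
  assumes "finite S" "{m. Some m \<in> Poly_Mapping.keys \<mu>} \<subseteq> S"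
    and "\<And>x. x \<notin> Poly_Mapping.keys \<mu> \<Longrightarrow> g x = (0 :: real)"
  shows "sum g (Poly_Mapping.keys \<mu>) = g None + (\<Sum>m\<in>S. g (Some m))"
proof -
  have "Poly_Mapping.keys \<mu> \<subseteq> insert None (Some ` S)"
  proof
    fix x assume "x \<in> Poly_Mapping.keys \<mu>"
    then show "x \<in> insert None (Some ` S)"
      using assms(2) by (cases x) auto
  qed
  then have "sum g (Poly_Mapping.keys \<mu>) = sum g (insert None (Some ` S))"
    using assms by (intro sum.mono_neutral_left) auto
  also have "\<dots> = g None + (\<Sum>m\<in>S. g (Some m))"
    using assms(1) by (simp add: sum.reindex)
  finally show ?thesis .
qed

section \<open>Failure of the BJNP by a gliding hump\<close>

lemma not_BJNP_cover_filter: "\<not> BJNP (NF_space cover_filter)"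
proof
  assume "BJNP (NF_space cover_filter)"
  then obtain \<mu> :: "nat \<Rightarrow> nat option \<Rightarrow>\<^sub>0 real" where norm: "\<And>n. measure_norm (\<mu> n) = 1"
    and lim_cont: "\<And>f. continuous_map (NF_space cover_filter) euclideanreal f \<and> bounded (range f) \<Longrightarrow>
             (\<lambda>n. measure_apply (\<mu> n) f) \<longlonglongrightarrow> 0"
    unfolding BJNP_def by auto
  have lim: "(\<lambda>n. measure_apply (\<mu> n) f) \<longlonglongrightarrow> 0"
    if "{m. f (Some m) \<noteq> f None} \<in> cover_ideal" "bounded (range f)" for f
  proof (rule lim_cont)
    have "- {m. f (Some m) = f None} \<in> cover_ideal"
      using that by (simp add: Compl_eq)
    then show "continuous_map (NF_space cover_filter) euclideanreal f \<and> bounded (range f)"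
      using that by (simp add: continuous_map_NF_space filter_sets_cover_filter)
  qed
  define c where "c n m = Poly_Mapping.lookup (\<mu> n) (Some m)" for n m
  define supp where "supp n = {m. Some m \<in> Poly_Mapping.keys (\<mu> n)}" for n
  define T where "T n l = (\<Sum>m | level m < l. \<bar>c n m\<bar>)" for n l
  have apply_eq: "measure_apply (\<mu> n) f
      = Poly_Mapping.lookup (\<mu> n) None * f None + (\<Sum>m\<in>S. c n m * f (Some m))"
    if "finite S" "supp n \<subseteq> S" for n f S
    unfolding measure_apply_def c_def using that
    by (intro sum_keys_option) (auto simp: supp_def in_keys_iff)
  have norm_eq: "\<bar>Poly_Mapping.lookup (\<mu> n) None\<bar> + (\<Sum>m\<in>S. \<bar>c n m\<bar>) = 1"
    if "finite S" "supp n \<subseteq> S" for n S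
    unfolding norm[of n, symmetric] measure_norm_def c_def using that
    by (intro sum_keys_option[symmetric]) (auto simp: supp_def in_keys_iff)
  have finite_supp: "finite (supp n)" for n
  proof -
    have "supp n = Some -` Poly_Mapping.keys (\<mu> n)"
      by (auto simp: supp_def)
    then show ?thesis
      by (simp add: finite_vimageI)
  qed
  \<comment> \<open>For empty support the value of \<open>Max\<close> is unspecified but harmless,
    since the inclusion is then trivial and \<open>max l\<close> still gives
    \<open>l' > l\<close>.\<close>
  have ex_level: "\<exists>l'>l. supp n \<subseteq> {m. level m < l'}" for n l
    using finite_supp[of n]
    by (intro exI[of _ "Suc (max l (Max (level ` supp n)))"]) (auto simp: less_Suc_eq_le le_max_iff_disj)

  \<comment> \<open>The indicator of a single point is a legal test function, because finite sets
    belong to the ideal.\<close>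
  have c_lim: "(\<lambda>n. c n m) \<longlonglongrightarrow> 0" for m
  proof -
    define f :: "nat option \<Rightarrow> real" where "f x = (if x = Some m then 1 else 0)" for x
    have "{k. f (Some k) \<noteq> f None} = {m}"
      by (auto simp: f_def)
    moreover have "bounded (range f)"
      by (rule finite_imp_bounded, rule finite_subset[of _ "{0, 1}"]) (auto simp: f_def)
    ultimately have "(\<lambda>n. measure_apply (\<mu> n) f) \<longlonglongrightarrow> 0"
      by (intro lim) (auto intro: finite_in_cover_ideal)
    moreover have "measure_apply (\<mu> n) f = c n m" for n
    proof -
      have "measure_apply (\<mu> n) f = (\<Sum>k\<in>insert m (supp n). c n k * f (Some k))"
        using apply_eq[of "insert m (supp n)" n f] finite_supp by (auto simp: f_def)
      also have "\<dots> = (\<Sum>k\<in>insert m (supp n). if k = m then c n k else 0)"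
        by (intro sum.cong refl) (auto simp: f_def)
      also have "\<dots> = c n m"
        using finite_supp by simp
      finally show ?thesis .
    qed
    ultimately show ?thesis
      by simp
  qed
  have "(\<lambda>n. T n l) \<longlonglongrightarrow> 0" for l
    unfolding T_def by (intro tendsto_null_sum tendsto_rabs_zero c_lim)
  then have T_small: "eventually (\<lambda>n. T n l < 1 / 16) sequentially" for l
    by (rule order_tendstoD) simp
  have "(\<lambda>n. measure_apply (\<mu> n) (\<lambda>_. 1)) \<longlonglongrightarrow> 0"
    by (rule lim) (auto intro: finite_in_cover_ideal)
  then have "(\<lambda>n. \<bar>measure_apply (\<mu> n) (\<lambda>_. 1)\<bar>) \<longlonglongrightarrow> 0"
    by (rule tendsto_rabs_zero)
  then have "eventually (\<lambda>n. \<bar>measure_apply (\<mu> n) (\<lambda>_. 1)\<bar> < 1 / 2) sequentially"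
    by (rule order_tendstoD) simp
  \<comment> \<open>Let a be the mass at \<open>None\<close> and b the signed sum of the other
    masses. Then |a| \<le> |a + b| + |b| < 1/2 + T and |a| + T = 1 give T > 1/4.\<close>
  then have T_large: "eventually (\<lambda>n. \<forall>l. supp n \<subseteq> {m. level m < l} \<longrightarrow> 1 / 4 \<le> T n l) sequentially"
  proof (rule eventually_mono, intro allI impI)
    fix n l
    assume *: "\<bar>measure_apply (\<mu> n) (\<lambda>_. 1)\<bar> < 1 / 2" and l: "supp n \<subseteq> {m. level m < l}"
    have "\<bar>\<Sum>m | level m < l. c n m\<bar> \<le> T n l"
      unfolding T_def by (rule sum_abs)
    moreover have "\<bar>Poly_Mapping.lookup (\<mu> n) None\<bar> + T n l = 1"
      using norm_eq[OF finite_level_less l] by (simp add: T_def)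
    moreover have "measure_apply (\<mu> n) (\<lambda>_. 1)
        = Poly_Mapping.lookup (\<mu> n) None + (\<Sum>m | level m < l. c n m)"
      using apply_eq[OF finite_level_less l, of "\<lambda>_. 1"] by simp
    ultimately show "1 / 4 \<le> T n l"
      using * by linarith
  qed

  \<comment> \<open>A pair consists of the index of a measure and the level where its hump starts.
    The bound \<open>k \<le> fst x\<close> makes the chosen indices unbounded; \<open>succ\<close>
    starts the next hump above the support of the previous measure.\<close>
  define good where "good k x \<longleftrightarrow> k \<le> fst x \<and> T (fst x) (snd x) < 1 / 16 \<and>
    (\<forall>l. supp (fst x) \<subseteq> {m. level m < l} \<longrightarrow> 1 / 4 \<le> T (fst x) l)" for k x
  define succ where "succ x y \<longleftrightarrow> snd x < snd y \<and> supp (fst x) \<subseteq> {m. level m < snd y}"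
    for x y :: "nat \<times> nat"
  have ex_good: "\<exists>n. good k (n, l)" for k l
  proof -
    have "eventually (\<lambda>n. good k (n, l)) sequentially"
      using eventually_ge_at_top[of k] T_small[of l] T_large
      by eventually_elim (simp add: good_def)
    then show ?thesis
      by (rule eventually_happens'[OF sequentially_bot])
  qed
  have ex_succ: "\<exists>y. good (Suc k) y \<and> succ x y" for x k
  proof -
    \<comment> \<open>The starting level is fixed first; only then is the measure chosen far enough
      out to have little mass below it.\<close>
    obtain l' where "snd x < l'" "supp (fst x) \<subseteq> {m. level m < l'}"
      using ex_level by blast
    moreover obtain n' where "good (Suc k) (n', l')"
      using ex_good by blast
    ultimately show ?thesis
      by (intro exI[of _ "(n', l')"]) (simp add: succ_def)
  qed
  have "\<exists>p. \<forall>k. good k (p k) \<and> succ (p k) (p (Suc k))"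
    by (rule dependent_nat_choice) (use ex_good ex_succ in blast)+
  then obtain p where p: "\<And>k. good k (p k)" "\<And>k. succ (p k) (p (Suc k))"
    by blast
  define N where "N k = fst (p k)" for k
  define L where "L k = snd (p k)" for k
  have N_ge: "k \<le> N k" and T_head: "T (N k) (L k) < 1 / 16"
    and T_total: "1 / 4 \<le> T (N k) (L (Suc k))"
    and L_less: "L k < L (Suc k)" and supp_L: "supp (N k) \<subseteq> {m. level m < L (Suc k)}" for k
    using p[of k] by (auto simp: N_def L_def good_def succ_def)
  have "strict_mono L"
    using L_less by (simp add: strict_mono_Suc_iff)
  \<comment> \<open>\<open>q l\<close> is the index of the measure whose hump contains level
    \<open>l\<close>. Levels below \<open>L 0\<close> get the default \<open>N 0\<close>; they lie
    only in heads, where nothing but \<open>s_le\<close> is used.\<close>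
  define q where "q l = N (LEAST k. l < L (Suc k))" for l
  have q: "q l = N k" if "L k \<le> l" "l < L (Suc k)" for k l
  proof -
    have "(LEAST k. l < L (Suc k)) = k"
    proof (rule Least_equality)
      fix j assume "l < L (Suc j)"
      then have "L k < L (Suc j)"
        using that by simp
      then show "k \<le> j"
        using \<open>strict_mono L\<close> by (simp add: strict_mono_less)
    qed (use that in simp)
    then show ?thesis
      by (simp add: q_def)
  qed
  have "\<exists>i. \<forall>l. i l < 2 ^ Suc l \<and> (\<Sum>m | level m = l. \<bar>c (q l) m\<bar>)
      \<le> 2 * (\<Sum>m | level m = l \<and> i l \<notin> missed m. \<bar>c (q l) m\<bar>)"
    by (intro choice allI ex_heavy_covering_set) simp
  then obtain i where i: "\<And>l. i l < 2 ^ Suc l"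
    and heavy: "\<And>l. (\<Sum>m | level m = l. \<bar>c (q l) m\<bar>)
      \<le> 2 * (\<Sum>m | level m = l \<and> i l \<notin> missed m. \<bar>c (q l) m\<bar>)"
    by blast
  \<comment> \<open>With these signs, \<open>c n m * s m\<close> equals the absolute mass on the
    heavy covering sets of the hump of \<open>n\<close> and vanishes on the rest of that
    hump.\<close>
  define s where "s m = (if i (level m) \<notin> missed m then sgn (c (q (level m)) m) else 0)" for m
  define f where "f x = (case x of None \<Rightarrow> 0 | Some m \<Rightarrow> s m)" for x
  have s_le: "\<bar>s m\<bar> \<le> 1" for m
    by (simp add: s_def sgn_if)
  have "{m. f (Some m) \<noteq> f None} \<in> cover_ideal"
    by (rule cover_ideal_subset[OF transversal_in_cover_ideal[OF i]]) (auto simp: f_def s_def)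
  moreover have "bounded (range f)"
    using s_le by (intro boundedI[of _ 1]) (auto simp: f_def split: option.split)
  ultimately have "(\<lambda>n. measure_apply (\<mu> n) f) \<longlonglongrightarrow> 0"
    by (rule lim)
  \<comment> \<open>The hump has mass above 1/4 - 1/16 = 3/16, of which at least half is collected,
    and the head costs less than 1/16. This leaves more than 3/32 - 2/32 = 1/32.\<close>
  then have "eventually (\<lambda>n. measure_apply (\<mu> n) f < 1 / 32) sequentially"
    by (rule order_tendstoD) simp
  then obtain k where k: "\<And>n. n \<ge> k \<Longrightarrow> measure_apply (\<mu> n) f < 1 / 32"
    by (auto simp: eventually_sequentially)

  define n where "n = N k"
  let ?head = "{m. level m < L k}" and ?block = "{m. L k \<le> level m \<and> level m < L (Suc k)}"
  have split: "(\<Sum>m | level m < L (Suc k). h m) = sum h ?head + sum h ?block"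
    for h :: "nat \<Rightarrow> real"
  proof -
    have "{m. level m < L (Suc k)} = ?head \<union> ?block"
      using L_less[of k] by auto
    moreover have "finite ?block"
      by (rule finite_subset[OF _ finite_level_less[of "L (Suc k)"]]) auto
    ultimately show ?thesis
      using finite_level_less[of "L k"] by (simp add: sum.union_disjoint disjoint_iff)
  qed
  have "measure_apply (\<mu> n) f = (\<Sum>m\<in>?head. c n m * s m) + (\<Sum>m\<in>?block. c n m * s m)"
    using apply_eq[OF finite_level_less supp_L[of k], where f = f] by (simp add: f_def n_def split)
  moreover have "- T n (L k) \<le> (\<Sum>m\<in>?head. c n m * s m)"
  proof -
    have "\<bar>\<Sum>m\<in>?head. c n m * s m\<bar> \<le> (\<Sum>m\<in>?head. \<bar>c n m * s m\<bar>)"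
      by (rule sum_abs)
    also have "\<dots> \<le> T n (L k)"
      unfolding T_def using s_le by (intro sum_mono) (simp add: abs_mult mult_left_le)
    finally show ?thesis
      by linarith
  qed
  moreover have "T n (L (Suc k)) - T n (L k) \<le> 2 * (\<Sum>m\<in>?block. c n m * s m)"
  proof -
    have "T n (L (Suc k)) - T n (L k) = (\<Sum>m\<in>?block. \<bar>c n m\<bar>)"
      by (simp add: T_def split)
    also have "\<dots> = (\<Sum>l = L k..<L (Suc k). \<Sum>m | level m = l. \<bar>c n m\<bar>)"
      by (rule sum_by_level)
    also have "\<dots> \<le> (\<Sum>l = L k..<L (Suc k). 2 * (\<Sum>m | level m = l. c n m * s m))"
    proof (rule sum_mono)
      fix l assume "l \<in> {L k..<L (Suc k)}"
      then have ql: "q l = n"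
        by (simp add: q n_def)
      have "(\<Sum>m | level m = l \<and> i l \<notin> missed m. \<bar>c n m\<bar>) = (\<Sum>m | level m = l. c n m * s m)"
        using finite_level[of l]
        by (intro sum.mono_neutral_cong_left) (auto simp: s_def ql abs_sgn)
      then show "(\<Sum>m | level m = l. \<bar>c n m\<bar>) \<le> 2 * (\<Sum>m | level m = l. c n m * s m)"
        using heavy[of l] by (simp add: ql)
    qed
    also have "\<dots> = 2 * (\<Sum>m\<in>?block. c n m * s m)"
      by (simp add: sum_by_level sum_distrib_left)
    finally show ?thesis .
  qed
  ultimately have "1 / 32 \<le> measure_apply (\<mu> n) f"
    using T_head[of k] T_total[of k] unfolding n_def by linarith
  then show False
    using k[of n] N_ge[of k] by (simp add: n_def)
qed

theorem mainTheorem14: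
  shows "\<exists>F :: nat filter. free_filter F \<and> fsigma_filter F \<and> P_filter F \<and> \<not> BJNP (NF_space F)"
  using free_cover_filter fsigma_cover_filter P_filter_cover_filter not_BJNP_cover_filter by blast

end
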